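(* Given an instance of binary Stochastic Submodular Set Cover with utility function $g$ and goal value $Q$ (and costs $c$, probabilities $p$), the Adaptive Dual Greedy (ADG) algorithm constructs a cover whose expected cost (over item states $x\sim D_p$) is at most $\alpha$ times the expected cost of the cover produced by an optimal strategy, where $\alpha=\max\frac{\sum_{j\in C(a)}g_{S,a}(j)}{Q-g(S,a)}$, the maximum being over all $a\in\{0,1\}^n$ and all $S\in\mathrm{Pref}(C(a))$ for which the denominator is nonzero. Here $C(a)$ is the sequence (set) of items tested by ADG when the item states are $a$, in order of testing, and $\mathrm{Pref}(C(a))$ is the set of (sets of items in) prefixes of $C(a)$.
   Context: Notation: $N=\{1,\dots,n\}$; partial assignments $b\in\{0,1,*\}^n$; $dom(b)=\{i:b_i\ne*\}$; $a\sim b$ means $a_i=b_i$ whenever $b_i\ne*$; $b_{x_i\leftarrow l}$ is $b$ with coordinate $i$ set to $l$; for $S\subseteq N$, $b^S$ agrees with $b$ on $S$ and is $*$ elsewhere; $g(S,b)=g(b^S)$; $g_{S,b}(j)=g(S\cup\{j\},b)-g(S,b)$; $g_b(i,l)=g(b_{x_i\leftarrow l})-g(b)$ if $b_i=*$ and $0$ otherwise. A utility function $g:\{0,1,*\}^n\to\mathbb{Z}_{\ge0}$ is monotone if $g(b_{x_i\leftarrow l})\ge g(b)$ whenever $b_i=*$, $l\in\{0,1\}$; submodular if $g(b_{x_i\leftarrow l})-g(b)\ge g(b'_{x_i\leftarrow l})-g(b')$ whenever $b'\sim b$, $b_i=b'_i=*$. Binary SSSC: costs $c_j\ge0$, $p\in[0,1]^n$,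 integer goal $Q\ge0$, monotone submodular $g$ with $g( *,\dots,* )=0$ and $g(x)=Q$ for all $x\in\{0,1\}^n$; item states $x$ drawn from the product distribution $D_p$ ($\Pr[x_j=1]=p_j$); a strategy adaptively tests items (testing $j$ costs $c_j$ and reveals $x_j$) until the observed partial assignment $b$ is a cover, $g(b)=Q$; its cost is the expected total testing cost; an optimal strategy minimizes it. Expected gains: for untested $j$, $E[g_b(j)]=p_j g_b(j,1)+(1-p_j)g_b(j,0)$ and $E[g_{S,b}(j)]=p_j\,g_{S,b_{x_j\leftarrow1}}(j)+(1-p_j)\,g_{S,b_{x_j\leftarrow0}}(j)$. ADG: initialize $b=( *,\dots,* )$, $y_S=0$ for all $S\subseteq N$, $F^0=\emptyset$, $l=0$. While $g(b)<Q$: $l\leftarrow l+1$; choose $j_l=\arg\min_{j\notin F^{l-1}}\frac{c_j-\sum_{S:y_S\ne0}E[g_{S,b}(j)]\,y_S}{E[g_b(j)]}$ (ratio treated as $+\infty$ when $E[g_b(j)]=0$); set $y_{F^{l-1}}$ to this minimum ratio value; test $j_l$, observing state $k$; $F^l=F^{l-1}\cup\{j_l\}$; $b_{j_l}=k$. Output $b$. *)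

theory Defs
  imports "HOL-Probability.Probability" "HOL-Probability.Product_PMF"
    "HOL-Library.While_Combinator" "HOL-Library.Sublist"
begin

text \<open>
  An element of $\{0,1,*\}^n$ is a map from items to \<^typ>\<open>bool\<close> with domain contained in
  \<open>{1..n}\<close>, where \<^term>\<open>None\<close> plays the role of $*$. Then $b_{x_i \leftarrow l}$ is \<open>b(i \<mapsto> l)\<close>,
  $b^S$ is \<open>b |` S\<close>, and $b' \sim b$ is \<open>b \<subseteq>\<^sub>m b'\<close>.
\<close>

type_synonym assignment = "nat \<rightharpoonup> bool"

definition partial_assignments :: "nat \<Rightarrow> assignment set" where
  "partial_assignments n = {b. dom b \<subseteq> {1..n}}"

definition full_assignments :: "nat \<Rightarrow> assignment set" where
  "full_assignments n = {a. dom a = {1..n}}"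

definition utility_monotone :: "nat \<Rightarrow> (assignment \<Rightarrow> nat) \<Rightarrow> bool" where
  "utility_monotone n g \<longleftrightarrow>
     (\<forall>b \<in> partial_assignments n. \<forall>i \<in> {1..n}. \<forall>l. b i = None \<longrightarrow> g b \<le> g (b(i \<mapsto> l)))"

definition utility_submodular :: "nat \<Rightarrow> (assignment \<Rightarrow> nat) \<Rightarrow> bool" where
  "utility_submodular n g \<longleftrightarrow>
     (\<forall>b \<in> partial_assignments n. \<forall>b' \<in> partial_assignments n. \<forall>i \<in> {1..n}. \<forall>l.
        b \<subseteq>\<^sub>m b' \<and> b i = None \<and> b' i = None \<longrightarrow>
        int (g (b(i \<mapsto> l))) - int (g b) \<ge> int (g (b'(i \<mapsto> l))) - int (g b'))"

definition sssc_instance ::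
  "nat \<Rightarrow> (assignment \<Rightarrow> nat) \<Rightarrow> nat \<Rightarrow> (nat \<Rightarrow> real) \<Rightarrow> (nat \<Rightarrow> real) \<Rightarrow> bool" where
  "sssc_instance n g Q c p \<longleftrightarrow>
     (\<forall>j \<in> {1..n}. 0 \<le> c j) \<and> (\<forall>j \<in> {1..n}. p j \<in> {0..1}) \<and>
     utility_monotone n g \<and> utility_submodular n g \<and>
     g Map.empty = 0 \<and> (\<forall>x \<in> full_assignments n. g x = Q)"

definition state_pmf :: "nat \<Rightarrow> (nat \<Rightarrow> real) \<Rightarrow> assignment pmf" where
  "state_pmf n p = Pi_pmf {1..n} None (\<lambda>j. map_pmf Some (bernoulli_pmf (p j)))"


text \<open>
  A strategy is a decision tree; \<open>Test j T\<^sub>0 T\<^sub>1\<close> tests item \<open>j\<close> and continues with \<open>T\<^sub>0\<close> if its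
  state is 0 and with \<open>T\<^sub>1\<close> if its state is 1.
\<close>

datatype strategy = Stop | Test nat strategy strategy

fun covers_from :: "nat \<Rightarrow> (assignment \<Rightarrow> nat) \<Rightarrow> nat \<Rightarrow> assignment \<Rightarrow> strategy \<Rightarrow> bool" where
  "covers_from n g Q b Stop \<longleftrightarrow> g b = Q"
| "covers_from n g Q b (Test j T0 T1) \<longleftrightarrow>
     g b \<noteq> Q \<and> j \<in> {1..n} \<and> b j = None \<and>
     covers_from n g Q (b(j \<mapsto> False)) T0 \<and> covers_from n g Q (b(j \<mapsto> True)) T1"

fun items_tested :: "strategy \<Rightarrow> assignment \<Rightarrow> nat list" where
  "items_tested Stop x = []"
| "items_tested (Test j T0 T1) x = j # items_tested (if x j = Some True then T1 else T0) x"

definition strategy_cost :: "nat \<Rightarrow> (nat \<Rightarrow> real) \<Rightarrow> (nat \<Rightarrow> real) \<Rightarrow> strategy \<Rightarrow> real" where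
  "strategy_cost n c p T =
     measure_pmf.expectation (state_pmf n p) (\<lambda>x. \<Sum>j\<leftarrow>items_tested T x. c j)"

definition optimal_strategy ::
  "nat \<Rightarrow> (assignment \<Rightarrow> nat) \<Rightarrow> nat \<Rightarrow> (nat \<Rightarrow> real) \<Rightarrow> (nat \<Rightarrow> real) \<Rightarrow> strategy \<Rightarrow> bool" where
  "optimal_strategy n g Q c p T \<longleftrightarrow>
     is_arg_min (strategy_cost n c p) (covers_from n g Q Map.empty) T"


definition item_gain :: "(assignment \<Rightarrow> nat) \<Rightarrow> assignment \<Rightarrow> nat \<Rightarrow> bool \<Rightarrow> real" where
  "item_gain g b i l = (if b i = None then real (g (b(i \<mapsto> l))) - real (g b) else 0)"

definition set_gain :: "(assignment \<Rightarrow> nat) \<Rightarrow> nat set \<Rightarrow> assignment \<Rightarrow> nat \<Rightarrow> real" where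
  "set_gain g S b j = real (g (b |` (S \<union> {j}))) - real (g (b |` S))"

definition exp_item_gain ::
  "(assignment \<Rightarrow> nat) \<Rightarrow> (nat \<Rightarrow> real) \<Rightarrow> assignment \<Rightarrow> nat \<Rightarrow> real" where
  "exp_item_gain g p b j = p j * item_gain g b j True + (1 - p j) * item_gain g b j False"

definition exp_set_gain ::
  "(assignment \<Rightarrow> nat) \<Rightarrow> (nat \<Rightarrow> real) \<Rightarrow> nat set \<Rightarrow> assignment \<Rightarrow> nat \<Rightarrow> real" where
  "exp_set_gain g p S b j =
     p j * set_gain g S (b(j \<mapsto> True)) j + (1 - p j) * set_gain g S (b(j \<mapsto> False)) j"


text \<open>
  In the state of the algorithm after \<open>l\<close> iterations, \<open>tested\<close> is the sequence of tested items (so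
  $F^l$ is its set of elements and \<open>l\<close> its length), \<open>obs\<close> is $b$ and \<open>dual\<close> is $y$.
\<close>

record adg_state =
  tested :: "nat list"
  obs :: assignment
  dual :: "nat set \<Rightarrow> real"

definition adg_init :: adg_state where
  "adg_init = \<lparr>tested = [], obs = Map.empty, dual = (\<lambda>S. 0)\<rparr>"

definition adg_ratio ::
  "nat \<Rightarrow> (assignment \<Rightarrow> nat) \<Rightarrow> (nat \<Rightarrow> real) \<Rightarrow> (nat \<Rightarrow> real) \<Rightarrow> adg_state \<Rightarrow> nat \<Rightarrow> ereal" where
  "adg_ratio n g c p st j =
     (if exp_item_gain g p (obs st) j = 0 then \<infinity>
      else ereal
        ((c j - (\<Sum>S | S \<subseteq> {1..n} \<and> dual st S \<noteq> 0. exp_set_gain g p S (obs st) j * dual st S))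
         / exp_item_gain g p (obs st) j))"

definition adg_minimizers ::
  "nat \<Rightarrow> (assignment \<Rightarrow> nat) \<Rightarrow> (nat \<Rightarrow> real) \<Rightarrow> (nat \<Rightarrow> real) \<Rightarrow> adg_state \<Rightarrow> nat set" where
  "adg_minimizers n g c p st =
     {j. is_arg_min (adg_ratio n g c p st) (\<lambda>j. j \<in> {1..n} - set (tested st)) j}"

text \<open>
  The minimizer of the ratio need not be unique. A tie-breaking rule chooses one of the minimizers;
  since it sees the whole state of the algorithm, it may depend on the history of the run.
\<close>

type_synonym tie_breaker = "adg_state \<Rightarrow> nat set \<Rightarrow> nat"

definition tie_breaking :: "tie_breaker \<Rightarrow> bool" where
  "tie_breaking sel \<longleftrightarrow> (\<forall>st A. A \<noteq> {} \<longrightarrow> sel st A \<in> A)"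

text \<open>
  The item states \<open>a\<close> enter a step only through the observed state \<open>a j\<close> of the selected item.
  While the goal is not reached the minimum ratio is finite, so \<^const>\<open>real_of_ereal\<close> loses nothing.
\<close>

definition adg_step ::
  "nat \<Rightarrow> (assignment \<Rightarrow> nat) \<Rightarrow> (nat \<Rightarrow> real) \<Rightarrow> (nat \<Rightarrow> real) \<Rightarrow> tie_breaker \<Rightarrow>
   assignment \<Rightarrow> adg_state \<Rightarrow> adg_state" where
  "adg_step n g c p sel a st =
     (let j = sel st (adg_minimizers n g c p st)
      in \<lparr>tested = tested st @ [j],
          obs = (obs st)(j := a j),
          dual = (dual st)(set (tested st) := real_of_ereal (adg_ratio n g c p st j))\<rparr>)"

definition adg ::
  "nat \<Rightarrow> (assignment \<Rightarrow> nat) \<Rightarrow> nat \<Rightarrow> (nat \<Rightarrow> real) \<Rightarrow> (nat \<Rightarrow> real) \<Rightarrow> tie_breaker \<Rightarrow>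
   assignment \<Rightarrow> adg_state option" where
  "adg n g Q c p sel a =
     while_option (\<lambda>st. g (obs st) < Q) (adg_step n g c p sel a) adg_init"

definition adg_items ::
  "nat \<Rightarrow> (assignment \<Rightarrow> nat) \<Rightarrow> nat \<Rightarrow> (nat \<Rightarrow> real) \<Rightarrow> (nat \<Rightarrow> real) \<Rightarrow> tie_breaker \<Rightarrow>
   assignment \<Rightarrow> nat list" where
  "adg_items n g Q c p sel a = tested (the (adg n g Q c p sel a))"

definition adg_cost ::
  "nat \<Rightarrow> (assignment \<Rightarrow> nat) \<Rightarrow> nat \<Rightarrow> (nat \<Rightarrow> real) \<Rightarrow> (nat \<Rightarrow> real) \<Rightarrow> tie_breaker \<Rightarrow> real" where
  "adg_cost n g Q c p sel =
     measure_pmf.expectation (state_pmf n p) (\<lambda>x. \<Sum>j\<leftarrow>adg_items n g Q c p sel x. c j)"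

definition prefix_sets :: "nat list \<Rightarrow> nat set set" where
  "prefix_sets xs = {set ys | ys. prefix ys xs}"

text \<open>
  The set below is empty only for \<open>Q = 0\<close>; then nothing needs to be tested and all costs are 0.
\<close>

definition adg_alpha ::
  "nat \<Rightarrow> (assignment \<Rightarrow> nat) \<Rightarrow> nat \<Rightarrow> (nat \<Rightarrow> real) \<Rightarrow> (nat \<Rightarrow> real) \<Rightarrow> tie_breaker \<Rightarrow> real" where
  "adg_alpha n g Q c p sel =
     Max {(\<Sum>j \<in> set (adg_items n g Q c p sel a). set_gain g S a j) / (real Q - real (g (a |` S))) | a S.
          a \<in> full_assignments n \<and> S \<in> prefix_sets (adg_items n g Q c p sel a) \<and>
          real Q - real (g (a |` S)) \<noteq> 0}"


lemma finite_covers_from: "finite {T. covers_from n g Q b T}"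
proof (induction "card ({1..n} - dom b)" arbitrary: b rule: less_induct)
  case less
  let ?X = "\<lambda>j l. {T. covers_from n g Q (b(j \<mapsto> l)) T}"
  let ?U = "\<Union>j \<in> {1..n} - dom b. (\<lambda>(T0, T1). Test j T0 T1) ` (?X j False \<times> ?X j True)"
  have fin: "finite (?X j l)" if j: "j \<in> {1..n} - dom b" for j l
  proof (rule less.hyps)
    show "card ({1..n} - dom (b(j \<mapsto> l))) < card ({1..n} - dom b)"
      using j by (intro psubset_card_mono) auto
  qed
  have "{T. covers_from n g Q b T} \<subseteq> insert Stop ?U"
  proof
    fix T assume "T \<in> {T. covers_from n g Q b T}"
    then show "T \<in> insert Stop ?U"
      by (cases T) (force simp: domIff)+
  qed
  moreover have "finite ?U" using fin by blast
  ultimately show ?case by (meson finite.insertI finite_subset)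
qed

lemma covers_from_exists:
  assumes full: "\<And>x. x \<in> full_assignments n \<Longrightarrow> g x = Q" and "dom b \<subseteq> {1..n}"
  shows "\<exists>T. covers_from n g Q b T"
  using assms(2)
proof (induction "card ({1..n} - dom b)" arbitrary: b rule: less_induct)
  case less
  show ?case
  proof (cases "g b = Q")
    case True
    then show ?thesis by (metis covers_from.simps(1))
  next
    case False
    then obtain j where j: "j \<in> {1..n}" "b j = None"
      using full[of b] less.prems unfolding full_assignments_def by blast
    have "\<exists>T. covers_from n g Q (b(j \<mapsto> l)) T" for l
    proof (rule less.hyps)
      show "card ({1..n} - dom (b(j \<mapsto> l))) < card ({1..n} - dom b)"
        using j by (intro psubset_card_mono) auto
      show "dom (b(j \<mapsto> l)) \<subseteq> {1..n}" using j less.prems by auto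
    qed
    then show ?thesis using False j by (metis covers_from.simps(2))
  qed
qed

lemma optimal_strategy_exists:
  assumes "sssc_instance n g Q c p"
  shows "\<exists>T. optimal_strategy n g Q c p T"
proof -
  let ?X = "{T. covers_from n g Q Map.empty T}"
  have "?X \<noteq> {}"
    using covers_from_exists[of n g Q Map.empty] assms by (auto simp: sssc_instance_def)
  then obtain T where "is_arg_min (strategy_cost n c p) (\<lambda>T. T \<in> ?X) T"
    using ex_is_arg_min_if_finite[OF finite_covers_from] by blast
  then show ?thesis by (auto simp: optimal_strategy_def)
qed

end

theory Submission
  imports Defs
begin

text \<open>
  Primal-dual argument. Call \<open>\<Sum>\<^sub>S y\<^sub>S g\<^sub>S\<^sub>,\<^sub>a(j)\<close> the charge of item \<open>j\<close> on the item states \<open>a\<close>, where \<open>y\<close> are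
  the duals at the end of the run of ADG on \<open>a\<close>. The duals \<open>y\<^sub>S\<close> with \<open>j \<notin> S\<close> are fixed before \<open>j\<close> is
  observed, and sets containing \<open>j\<close> do not contribute to its charge. Hence, averaged over the state
  of \<open>j\<close>, the charge is at most \<open>c\<^sub>j\<close>, by the choice of the minimum ratio, and equal to \<open>c\<^sub>j\<close> if ADG tests
  \<open>j\<close>. So the expected cost of ADG is the expected total charge of the items that it tests, which is
  at most \<open>\<alpha>\<close> times the expectation of \<open>\<Sum>\<^sub>S y\<^sub>S (Q - g(S,a))\<close>. On the other hand, by submodularity this
  expectation is at most the expected total charge of the items tested by any covering strategy, and
  therefore at most the expected cost of that strategy.
\<close>

section \<open>Item states and their distribution\<close>

lemma finite_full_assignments: "finite (full_assignments n)"
proof -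
  have "full_assignments n = {a. dom a = {1..n} \<and> ran a \<subseteq> UNIV}"
    by (auto simp: full_assignments_def)
  then show ?thesis
    using finite_set_of_finite_maps[of "{1..n}" "UNIV :: bool set"] by simp
qed

lemma full_assignments_obtain:
  assumes "a \<in> full_assignments n" "j \<in> {1..n}"
  obtains l where "a j = Some l"
  using assms unfolding full_assignments_def by blast

lemma full_assignments_restrict:
  assumes "a \<in> full_assignments n" "{1..n} \<subseteq> S"
  shows "a |` S = a"
proof
  fix i
  show "(a |` S) i = a i"
  proof (cases "a i")
    case None
    then show ?thesis by (simp add: restrict_map_def)
  next
    case (Some l)
    then have "i \<in> S" using assms by (auto simp: full_assignments_def)
    then show ?thesis by simp
  qed
qed

lemma set_state_pmf: "set_pmf (state_pmf n p) \<subseteq> full_assignments n"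
proof
  fix a assume "a \<in> set_pmf (state_pmf n p)"
  then have a: "a \<in> PiE_dflt {1..n} None (set_pmf \<circ> (\<lambda>j. map_pmf Some (bernoulli_pmf (p j))))"
    by (simp add: state_pmf_def set_Pi_pmf)
  have "a i \<noteq> None \<longleftrightarrow> i \<in> {1..n}" for i
    using a by (cases "i \<in> {1..n}") (force simp: PiE_dflt_def)+
  then show "a \<in> full_assignments n" unfolding full_assignments_def dom_def by auto
qed

lemma integrable_state_pmf: "integrable (measure_pmf (state_pmf n p)) (f :: assignment \<Rightarrow> real)"
  using finite_subset[OF set_state_pmf finite_full_assignments]
  by (rule integrable_measure_pmf_finite)

lemma expectation_mono_full:
  assumes "\<And>a. a \<in> full_assignments n \<Longrightarrow> (f a :: real) \<le> h a"
  shows "measure_pmf.expectation (state_pmf n p) f \<le> measure_pmf.expectation (state_pmf n p) h"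
  using set_state_pmf[of n p] assms
  by (intro integral_mono_AE integrable_state_pmf) (auto simp: AE_measure_pmf_iff)

lemma expectation_cong_full:
  assumes "\<And>a. a \<in> full_assignments n \<Longrightarrow> (f a :: real) = h a"
  shows "measure_pmf.expectation (state_pmf n p) f = measure_pmf.expectation (state_pmf n p) h"
  using expectation_mono_full[of n f h p] expectation_mono_full[of n h f p] assms by force

text \<open>The conditional expectation of \<open>f\<close> given the states of all items other than
  \<open>j\<close>.\<close>

definition resample :: "(nat \<Rightarrow> real) \<Rightarrow> nat \<Rightarrow> (assignment \<Rightarrow> real) \<Rightarrow> assignment \<Rightarrow> real" where
  "resample p j f a = p j * f (a(j \<mapsto> True)) + (1 - p j) * f (a(j \<mapsto> False))"

text \<open>Tower property: by independence the state of \<open>j\<close> can be drawn apart from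
  the states \<open>R\<close> of the other items.\<close>

lemma expectation_resample:
  assumes j: "j \<in> {1..n}" and p: "p j \<in> {0..1}"
  shows "measure_pmf.expectation (state_pmf n p) (resample p j f)
       = measure_pmf.expectation (state_pmf n p) f"
proof -
  define R where "R = Pi_pmf ({1..n} - {j}) None (\<lambda>j. map_pmf Some (bernoulli_pmf (p j)))"
  have fin: "finite (set_pmf R)"
    unfolding R_def
    by (subst set_Pi_pmf) auto
  have "state_pmf n p
      = bind_pmf (bernoulli_pmf (p j)) (\<lambda>l. bind_pmf R (\<lambda>x. return_pmf (x(j := Some l))))"
    using j Pi_pmf_insert'[of "{1..n} - {j}" j None "\<lambda>j. map_pmf Some (bernoulli_pmf (p j))"]
    by (simp add: state_pmf_def R_def insert_absorb bind_map_pmf)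
  then have eq: "state_pmf n p = bind_pmf (bernoulli_pmf (p j)) (\<lambda>l. map_pmf (\<lambda>x. x(j := Some l)) R)"
    by (simp add: map_pmf_def)
  have E: "measure_pmf.expectation (state_pmf n p) h
      = measure_pmf.expectation R (resample p j h)" for h :: "assignment \<Rightarrow> real"
  proof -
    have "measure_pmf.expectation (state_pmf n p) h
      = (\<Sum>l\<in>UNIV. pmf (bernoulli_pmf (p j)) l *\<^sub>R
           measure_pmf.expectation (map_pmf (\<lambda>x. x(j := Some l)) R) h)"
      unfolding eq by (rule pmf_expectation_bind) (use fin in auto)
    also have "\<dots> = p j * measure_pmf.expectation R (\<lambda>x. h (x(j \<mapsto> True)))
      + (1 - p j) * measure_pmf.expectation R (\<lambda>x. h (x(j \<mapsto> False)))"
      using p by (simp add: UNIV_bool)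
    also have "\<dots> = measure_pmf.expectation R (resample p j h)"
      unfolding resample_def by (simp add: integrable_measure_pmf_finite fin)
    finally show ?thesis .
  qed
  \<comment> \<open>A second resampling has nothing left to average, so \<open>E\<close> gives the
    same value for \<open>f\<close> and \<open>resample p j f\<close>.\<close>
  have "resample p j (resample p j f) = resample p j f"
    by (auto simp: resample_def fun_eq_iff algebra_simps)
  then show ?thesis by (simp add: E)
qed

section \<open>Items tested by a decision tree\<close>

text \<open>Until it tests \<open>j\<close>, the tree branches alike on both assignments; later
  branches do not matter, as \<open>j\<close> is then listed.\<close>

lemma items_tested_update_iff:
  "j \<in> set (items_tested T (a(j := v))) \<longleftrightarrow> j \<in> set (items_tested T a)"
  by (induction T) auto

text \<open>For the induction, \<open>b\<close> is the observation at the current node. A node tests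
  only items outside \<open>dom b\<close>, hence no item twice.\<close>

lemma items_tested_covers:
  assumes "covers_from n g Q b T" "b \<subseteq>\<^sub>m a" "a \<in> full_assignments n"
  shows "distinct (items_tested T a) \<and> set (items_tested T a) \<subseteq> {1..n} - dom b \<and>
    g (a |` (dom b \<union> set (items_tested T a))) = Q"
  using assms
proof (induction T arbitrary: b)
  case Stop
  have "a |` dom b = b"
    using Stop.prems(2) by (auto simp: restrict_map_def map_le_def fun_eq_iff domIff)
  then show ?case using Stop.prems by simp
next
  case (Test j T0 T1)
  then have "j \<in> {1..n}" by simp
  then obtain l where l: "a j = Some l" using full_assignments_obtain[OF Test.prems(3)] by blast
  define T where "T = (if l then T1 else T0)"
  have le: "b(j \<mapsto> l) \<subseteq>\<^sub>m a" using Test.prems l by (auto simp: map_le_def)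
  have "distinct (items_tested T a) \<and> set (items_tested T a) \<subseteq> {1..n} - dom (b(j \<mapsto> l)) \<and>
    g (a |` (dom (b(j \<mapsto> l)) \<union> set (items_tested T a))) = Q"
  proof (cases l)
    case True
    then show ?thesis
      using Test.IH(2)[of "b(j \<mapsto> l)"] Test.prems le unfolding T_def by (simp del: fun_upd_apply)
  next
    case False
    then show ?thesis
      using Test.IH(1)[of "b(j \<mapsto> l)"] Test.prems le unfolding T_def by (simp del: fun_upd_apply)
  qed
  moreover have "items_tested (Test j T0 T1) a = j # items_tested T a"
    by (simp add: l T_def)
  ultimately show ?case using Test.prems by auto
qed

section \<open>Marginal gains\<close>

lemma set_gain_mem: "j \<in> S \<Longrightarrow> set_gain g S b j = 0"
  by (simp add: set_gain_def insert_absorb)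

lemma exp_set_gain_mem: "j \<in> S \<Longrightarrow> exp_set_gain g p S b j = 0"
  by (simp add: exp_set_gain_def set_gain_mem)

lemma set_gain_cong: "(\<And>i. i \<in> insert j S \<Longrightarrow> a i = b i) \<Longrightarrow> set_gain g S a j = set_gain g S b j"
  unfolding set_gain_def
  by (intro arg_cong2[where f = "(-)"] arg_cong[where f = "\<lambda>x. real (g x)"])
    (auto simp: restrict_map_def)

lemma exp_set_gain_cong:
  assumes "\<And>i. i \<in> S \<Longrightarrow> i \<noteq> j \<Longrightarrow> a i = b i"
  shows "exp_set_gain g p S a j = exp_set_gain g p S b j"
proof -
  have "set_gain g S (a(j \<mapsto> l)) j = set_gain g S (b(j \<mapsto> l)) j" for l
    using assms by (intro set_gain_cong) auto
  then show ?thesis by (simp add: exp_set_gain_def)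
qed

text \<open>With \<open>F\<close> the tested set, this makes the denominator of the ADG ratio the
  coefficient of the dual of \<open>F\<close> in the constraint of \<open>j\<close>.\<close>

lemma exp_set_gain_observed:
  assumes "j \<notin> F"
  shows "exp_set_gain g p F a j = exp_item_gain g p (a |` F) j"
proof -
  have "(a(j \<mapsto> l)) |` insert j F = (a |` F)(j \<mapsto> l)" "(a(j \<mapsto> l)) |` F = a |` F" for l
    using assms by (auto simp: restrict_map_def)
  then show ?thesis
    using assms by (simp add: exp_set_gain_def exp_item_gain_def set_gain_def item_gain_def)
qed

section \<open>Monotonicity and submodularity along sets of items\<close>

locale adg_setting =
  fixes n Q :: nat and g :: "assignment \<Rightarrow> nat" and c p :: "nat \<Rightarrow> real" and sel :: tie_breaker
  assumes inst: "sssc_instance n g Q c p" and tie: "tie_breaking sel"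
begin

lemma prob: "j \<in> {1..n} \<Longrightarrow> p j \<in> {0..1}" and cost_nonneg: "j \<in> {1..n} \<Longrightarrow> 0 \<le> c j"
  and g_empty: "g Map.empty = 0" and g_full: "a \<in> full_assignments n \<Longrightarrow> g a = Q"
  using inst by (auto simp: sssc_instance_def)

text \<open>Add the items of \<open>T\<close> to \<open>S\<close> one by one: none lowers
  \<open>g\<close>, and by submodularity none adds more than it would to \<open>S\<close>
  alone.\<close>

lemma g_mono_submodular:
  assumes a: "a \<in> full_assignments n" and T: "T \<subseteq> {1..n}"
  shows "g (a |` S) \<le> g (a |` (S \<union> T)) \<and>
    real (g (a |` (S \<union> T))) - real (g (a |` S)) \<le> (\<Sum>j\<in>T. set_gain g S a j)"
proof -
  have pa: "a |` U \<in> partial_assignments n" for U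
    using a by (auto simp: full_assignments_def partial_assignments_def)
  have step: "g (a |` U) \<le> g (a |` insert j U)"
      "V \<subseteq> U \<Longrightarrow> real (g (a |` insert j U)) - real (g (a |` U)) \<le> set_gain g V a j"
    if j: "j \<in> {1..n}" "j \<notin> U" for U V j
  proof -
    obtain l where l: "a j = Some l" using full_assignments_obtain[OF a j(1)] .
    have upd: "a |` insert j W = (a |` W)(j \<mapsto> l)" for W
      using l by (auto simp: restrict_map_def)
    show "g (a |` U) \<le> g (a |` insert j U)"
      using inst pa[of U] j unfolding sssc_instance_def utility_monotone_def upd by auto
    assume V: "V \<subseteq> U"
    then have "a |` V \<subseteq>\<^sub>m a |` U" by (auto simp: map_le_def restrict_map_def)
    moreover have "utility_submodular n g" using inst by (simp add: sssc_instance_def)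
    moreover have "(a |` V) j = None" "(a |` U) j = None"
      using j V by (auto simp: restrict_map_def)
    ultimately have "int (g ((a |` U)(j \<mapsto> l))) - int (g (a |` U))
        \<le> int (g ((a |` V)(j \<mapsto> l))) - int (g (a |` V))"
      using pa[of U] pa[of V] j(1) unfolding utility_submodular_def by blast
    then show "real (g (a |` insert j U)) - real (g (a |` U)) \<le> set_gain g V a j"
      unfolding set_gain_def Un_insert_right Un_empty_right upd by linarith
  qed
  have "finite T" using T finite_subset by blast
  then show ?thesis using T
  proof (induction T)
    case (insert j T)
    show ?case
    proof (cases "j \<in> S \<union> T")
      case True
      then have "j \<in> S" using insert.hyps by auto
      then show ?thesis
        using insert by (simp add: insert_absorb set_gain_mem)
    next
      case False
      then show ?thesis
        using insert step(1)[of j "S \<union> T"] step(2)[of j "S \<union> T" S] by auto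
    qed
  qed simp
qed

lemma set_gain_nonneg:
  assumes "a \<in> full_assignments n" "j \<in> {1..n}"
  shows "0 \<le> set_gain g S a j"
  using g_mono_submodular[of a "{j}" S] assms by (simp add: set_gain_def)

lemma full_upd: "a \<in> full_assignments n \<Longrightarrow> j \<in> {1..n} \<Longrightarrow> a(j \<mapsto> l) \<in> full_assignments n"
  by (auto simp: full_assignments_def)

lemma exp_set_gain_nonneg:
  assumes "a \<in> full_assignments n" "j \<in> {1..n}"
  shows "0 \<le> exp_set_gain g p S a j"
  using prob[OF assms(2)] set_gain_nonneg[OF full_upd[OF assms] assms(2)]
  by (auto simp: exp_set_gain_def)

lemma g_restrict_le: "a \<in> full_assignments n \<Longrightarrow> g (a |` S) \<le> Q"
  using g_mono_submodular[of a "{1..n}" S] g_full[of a]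
  by (simp add: full_assignments_restrict)

text \<open>
  Completing the observation by states of positive probability reaches the goal, so by
  submodularity some single item already makes progress with positive probability.
\<close>

lemma exists_useful_item:
  assumes a: "a \<in> full_assignments n" and F: "F \<subseteq> {1..n}" and g: "g (a |` F) < Q"
  shows "\<exists>j \<in> {1..n} - F. exp_set_gain g p F a j > 0"
proof -
  define x where "x = (\<lambda>i. if i \<in> F \<or> i \<notin> {1..n} then a i else Some (p i > 0))"
  have x: "x \<in> full_assignments n"
    using a F unfolding full_assignments_def x_def dom_def by (auto split: if_splits)
  have xF: "x |` F = a |` F" by (auto simp: x_def restrict_map_def)
  have "F \<union> ({1..n} - F) = {1..n}" using F by auto
  moreover have "x |` {1..n} = x" using full_assignments_restrict[OF x] by simp
  ultimately have "0 < (\<Sum>j\<in>{1..n} - F. set_gain g F x j)"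
    using g_mono_submodular[OF x, of "{1..n} - F" F] g_full[OF x] g by (simp add: xF)
  then obtain j where j: "j \<in> {1..n} - F" and pos: "set_gain g F x j > 0"
    by (metis not_less sum_nonpos)
  have eq: "exp_set_gain g p F a j = exp_set_gain g p F x j"
    by (rule exp_set_gain_cong) (auto simp: x_def)
  \<comment> \<open>The positive gain on \<open>x\<close> is one of the two outcomes averaged, and
    \<open>x\<close> gives \<open>j\<close> a state of positive probability.\<close>
  have "x(j \<mapsto> (p j > 0)) = x" using j by (auto simp: x_def)
  then have "set_gain g F (x(j \<mapsto> (p j > 0))) j > 0" using pos by simp
  moreover have "0 \<le> set_gain g F (x(j \<mapsto> l)) j" for l
    using set_gain_nonneg[OF full_upd[OF x]] j by auto
  ultimately have "exp_set_gain g p F x j > 0"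
    using prob[of j] j unfolding exp_set_gain_def
    by (cases "p j > 0") (auto intro!: add_pos_nonneg mult_nonneg_nonneg simp del: fun_upd_apply)
  then show ?thesis using j eq by metis
qed

section \<open>Dual feasibility of ADG\<close>

text \<open>Left-hand side of the dual constraint of \<open>j\<close>, which demands
  \<open>load a y j\<close> \<le> \<open>c j\<close>. It does not depend on
  \<open>a j\<close>.\<close>

definition load :: "assignment \<Rightarrow> (nat set \<Rightarrow> real) \<Rightarrow> nat \<Rightarrow> real" where
  "load a y j = (\<Sum>S\<in>Pow {1..n}. exp_set_gain g p S a j * y S)"

text \<open>Dual feasibility, with equality for tested items. Strictness in
  \<open>S \<subset> set (tested st)\<close> keeps the next dual to be set at 0; the prefix and goal
  conditions put \<open>S\<close> in the range of the maximum \<alpha>.\<close>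

definition adg_inv :: "assignment \<Rightarrow> adg_state \<Rightarrow> bool" where
  "adg_inv a st \<longleftrightarrow>
     obs st = a |` set (tested st) \<and> distinct (tested st) \<and> set (tested st) \<subseteq> {1..n} \<and>
     (\<forall>S. 0 \<le> dual st S) \<and>
     (\<forall>S. dual st S \<noteq> 0 \<longrightarrow> S \<in> prefix_sets (tested st) \<and> S \<subset> set (tested st) \<and> g (a |` S) < Q) \<and>
     (\<forall>j\<in>{1..n}. load a (dual st) j \<le> c j) \<and>
     (\<forall>j\<in>set (tested st). load a (dual st) j = c j)"

text \<open>Nonzero duals sit on subsets of the tested set, where \<open>obs st\<close> and
  \<open>a\<close> agree. The ratio is thus the slack of a constraint over the coefficient of the
  dual about to be set.\<close>

lemma adg_ratio_load:
  assumes "adg_inv a st" "j \<in> {1..n} - set (tested st)"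
  shows "adg_ratio n g c p st j =
    (if exp_set_gain g p (set (tested st)) a j = 0 then \<infinity>
     else ereal ((c j - load a (dual st) j) / exp_set_gain g p (set (tested st)) a j))"
proof -
  have "(\<Sum>S | S \<subseteq> {1..n} \<and> dual st S \<noteq> 0. exp_set_gain g p S (obs st) j * dual st S)
      = load a (dual st) j"
    unfolding load_def
  proof (rule sum.mono_neutral_cong_left)
    fix S assume "S \<in> {S. S \<subseteq> {1..n} \<and> dual st S \<noteq> 0}"
    then have "S \<subseteq> set (tested st)" "obs st = a |` set (tested st)"
      using assms(1) by (auto simp: adg_inv_def)
    then have "exp_set_gain g p S (obs st) j = exp_set_gain g p S a j"
      by (intro exp_set_gain_cong) auto
    then show "exp_set_gain g p S (obs st) j * dual st S = exp_set_gain g p S a j * dual st S"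
      by simp
  qed auto
  moreover have "exp_item_gain g p (obs st) j = exp_set_gain g p (set (tested st)) a j"
    using assms exp_set_gain_observed by (simp add: adg_inv_def)
  ultimately show ?thesis by (simp add: adg_ratio_def)
qed

text \<open>The dual of the tested set rises from 0 to \<open>r\<close>, where the first constraint
  of an untested item with positive coefficient is tight.\<close>

lemma adg_step_cases:
  assumes a: "a \<in> full_assignments n" and inv: "adg_inv a st" and g: "g (obs st) < Q"
  obtains j r where "j \<in> {1..n} - set (tested st)" "0 \<le> r"
    "adg_step n g c p sel a st = \<lparr>tested = tested st @ [j], obs = (obs st)(j := a j),
       dual = (dual st)(set (tested st) := r)\<rparr>"
    "load a (dual st) j + exp_set_gain g p (set (tested st)) a j * r = c j"
    "\<And>i. i \<in> {1..n} - set (tested st) \<Longrightarrow>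
      load a (dual st) i + exp_set_gain g p (set (tested st)) a i * r \<le> c i"
proof -
  let ?F = "set (tested st)" and ?M = "adg_minimizers n g c p st"
  let ?e = "exp_set_gain g p (set (tested st)) a"
  define j where "j = sel st ?M"
  have F: "?F \<subseteq> {1..n}" "g (a |` ?F) < Q" using inv g by (auto simp: adg_inv_def)
  obtain k where k: "k \<in> {1..n} - ?F" "?e k > 0"
    using exists_useful_item[OF a F] by blast
  have "\<exists>i. is_arg_min (adg_ratio n g c p st) (\<lambda>j. j \<in> {1..n} - ?F) i"
    using k(1) by (intro ex_is_arg_min_if_finite) blast+
  then have "?M \<noteq> {}" unfolding adg_minimizers_def by blast
  then have "j \<in> ?M" using tie by (simp add: tie_breaking_def j_def)
  then have j: "j \<in> {1..n} - ?F"
    and min: "\<And>i. i \<in> {1..n} - ?F \<Longrightarrow> adg_ratio n g c p st j \<le> adg_ratio n g c p st i"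
    by (auto simp: adg_minimizers_def is_arg_min_linorder)
  define r where "r = (c j - load a (dual st) j) / ?e j"
  \<comment> \<open>\<open>k\<close> has a finite ratio, hence so does the minimizer
    \<open>j\<close>.\<close>
  have ej: "?e j \<noteq> 0"
    using min[OF k(1)] k(2) unfolding adg_ratio_load[OF inv j] adg_ratio_load[OF inv k(1)] by auto
  then have ej: "?e j > 0" using exp_set_gain_nonneg[OF a, of j ?F] j by simp
  have ratio: "adg_ratio n g c p st j = ereal r"
    using ej by (simp add: adg_ratio_load[OF inv j] r_def)
  have slack: "load a (dual st) i \<le> c i" if "i \<in> {1..n}" for i
    using inv that by (auto simp: adg_inv_def)
  show ?thesis
  proof (rule that[OF j])
    show "0 \<le> r" using slack[of j] j ej by (simp add: r_def)
    show "adg_step n g c p sel a st = \<lparr>tested = tested st @ [j], obs = (obs st)(j := a j),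
       dual = (dual st)(?F := r)\<rparr>"
      unfolding adg_step_def j_def[symmetric] Let_def by (simp add: ratio)
    show "load a (dual st) j + ?e j * r = c j" using ej by (simp add: r_def)
    show "load a (dual st) i + ?e i * r \<le> c i" if i: "i \<in> {1..n} - ?F" for i
    proof (cases "?e i = 0")
      case True
      then show ?thesis using slack[of i] i by simp
    next
      case False
      then have "?e i > 0" using exp_set_gain_nonneg[OF a, of i ?F] i by simp
      moreover have "r \<le> (c i - load a (dual st) i) / ?e i"
        using min[OF i] False unfolding ratio adg_ratio_load[OF inv i] by simp
      ultimately show ?thesis by (simp add: field_simps)
    qed
  qed
qed

lemma load_upd:
  assumes "F \<subseteq> {1..n}" "y F = 0"
  shows "load a (y(F := r)) j = load a y j + exp_set_gain g p F a j * r"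
  using assms unfolding load_def
  by (subst (1 2) sum.remove[of _ F]) (auto intro!: sum.cong)

text \<open>The new dual has coefficient 0 for items tested before, so their constraints stay tight;
  the choice of \<open>r\<close> settles the others.\<close>

lemma adg_inv_step:
  assumes a: "a \<in> full_assignments n" and inv: "adg_inv a st" and g: "g (obs st) < Q"
  shows "adg_inv a (adg_step n g c p sel a st)"
proof -
  obtain j r where j: "j \<in> {1..n} - set (tested st)" and r: "0 \<le> r"
    and st: "adg_step n g c p sel a st = \<lparr>tested = tested st @ [j], obs = (obs st)(j := a j),
       dual = (dual st)(set (tested st) := r)\<rparr>"
    and tight: "load a (dual st) j + exp_set_gain g p (set (tested st)) a j * r = c j"
    and feas: "\<And>i. i \<in> {1..n} - set (tested st) \<Longrightarrow>
      load a (dual st) i + exp_set_gain g p (set (tested st)) a i * r \<le> c i"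
    by (rule adg_step_cases[OF assms]) (rule that)
  let ?F = "set (tested st)"
  have F: "?F \<subseteq> {1..n}" and dF: "dual st ?F = 0" and obs: "obs st = a |` ?F"
    using inv by (auto simp: adg_inv_def)
  have load: "load a ((dual st)(?F := r)) i = load a (dual st) i + exp_set_gain g p ?F a i * r" for i
    using F dF by (rule load_upd)
  have mem: "load a ((dual st)(?F := r)) i = c i" if "i \<in> ?F" for i
    using inv that by (simp add: load exp_set_gain_mem adg_inv_def)
  have pre: "S \<in> prefix_sets (tested st @ [j]) \<and> S \<subset> insert j ?F \<and> g (a |` S) < Q"
    if "((dual st)(?F := r)) S \<noteq> 0" for S
  proof (cases "S = ?F")
    case True
    then show ?thesis using j g obs by (auto simp: prefix_sets_def)
  next
    case False
    then have "S \<in> prefix_sets (tested st)" "S \<subset> ?F" "g (a |` S) < Q"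
      using that inv by (auto simp: adg_inv_def)
    then show ?thesis by (auto simp: prefix_sets_def intro: prefix_prefix)
  qed
  have "(obs st)(j := a j) = a |` insert j ?F"
    unfolding obs by (auto simp: restrict_map_def)
  moreover have "load a ((dual st)(?F := r)) i \<le> c i" if "i \<in> {1..n}" for i
    using mem[of i] feas[of i] load[of i] that by (cases "i \<in> ?F") auto
  ultimately show ?thesis
    unfolding st adg_inv_def adg_state.simps set_append list.set Un_insert_right Un_empty_right
    using inv j r F mem load[of j] tight pre by (auto simp: adg_inv_def)
qed

section \<open>Complete runs of ADG\<close>

lemma adg_inv_init: "adg_inv a adg_init"
  by (auto simp: adg_inv_def adg_init_def load_def cost_nonneg)

text \<open>
  Idling once the goal is reached makes the runs on different item states comparable in lockstep.
\<close>

definition adg_next :: "assignment \<Rightarrow> adg_state \<Rightarrow> adg_state" where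
  "adg_next a st = (if g (obs st) < Q then adg_step n g c p sel a st else st)"

definition adg_final :: "assignment \<Rightarrow> adg_state" where
  "adg_final a = (adg_next a ^^ n) adg_init"

lemma adg_inv_iterate:
  assumes "a \<in> full_assignments n"
  shows "adg_inv a ((adg_next a ^^ k) adg_init)"
  by (induction k) (auto simp: adg_next_def adg_inv_init adg_inv_step[OF assms])

text \<open>A run short of the goal has never idled, so each iteration has added one item.\<close>

lemma length_tested_iterate:
  "g (obs ((adg_next a ^^ k) adg_init)) < Q \<Longrightarrow> length (tested ((adg_next a ^^ k) adg_init)) = k"
  by (induction k) (auto simp: adg_next_def adg_init_def adg_step_def Let_def split: if_splits)

lemma adg_inv_final: "a \<in> full_assignments n \<Longrightarrow> adg_inv a (adg_final a)"
  unfolding adg_final_def by (rule adg_inv_iterate)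

text \<open>If \<open>n\<close> iterations fell short, they would have tested all \<open>n\<close>
  items, but \<open>g\<close> is \<open>Q\<close> on full assignments.\<close>

lemma adg_final_covers:
  assumes a: "a \<in> full_assignments n"
  shows "g (obs (adg_final a)) = Q"
proof (rule ccontr)
  assume ne: "g (obs (adg_final a)) \<noteq> Q"
  have inv: "adg_inv a (adg_final a)" by (rule adg_inv_final[OF a])
  then have obs: "obs (adg_final a) = a |` set (tested (adg_final a))"
    and d: "distinct (tested (adg_final a))" "set (tested (adg_final a)) \<subseteq> {1..n}"
    by (auto simp: adg_inv_def)
  have "g (obs (adg_final a)) < Q" using ne g_restrict_le[OF a] obs by (simp add: le_neq_implies_less)
  then have "card (set (tested (adg_final a))) = n"
    using length_tested_iterate[where a = a and k = n] d by (simp add: adg_final_def distinct_card)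
  then have "set (tested (adg_final a)) = {1..n}"
    using d by (intro card_subset_eq) auto
  then have "obs (adg_final a) = a"
    using obs full_assignments_restrict[OF a] by simp
  then show False using ne g_full[OF a] by simp
qed

lemma adg_eq_final:
  assumes a: "a \<in> full_assignments n"
  shows "adg n g Q c p sel a = Some (adg_final a)"
proof -
  let ?W = "while_option (\<lambda>st. g (obs st) < Q) (adg_step n g c p sel a)"
  \<comment> \<open>Unfolding the loop once: taking a step before entering it, or idling, leaves its
    result unchanged.\<close>
  have "?W (adg_next a st) = ?W st" for st
    using while_option_unfold[of "\<lambda>st. g (obs st) < Q" "adg_step n g c p sel a" st]
    by (simp add: adg_next_def)
  then have "?W ((adg_next a ^^ k) st) = ?W st" for k st
    by (induction k) auto
  then have "adg n g Q c p sel a = ?W (adg_final a)"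
    by (simp add: adg_def adg_final_def)
  also have "\<dots> = Some (adg_final a)"
    by (subst while_option_unfold) (simp add: adg_final_covers[OF a])
  finally show ?thesis .
qed

section \<open>Dependence of a run on the state of one item\<close>

text \<open>
  The run cannot depend on the state of item \<open>j\<close> before \<open>j\<close> is tested, and the duals set afterwards
  belong to sets containing \<open>j\<close>.
\<close>

definition agree_off :: "nat \<Rightarrow> adg_state \<Rightarrow> adg_state \<Rightarrow> bool" where
  "agree_off j st st' \<longleftrightarrow>
     (j \<notin> set (tested st) \<and> st = st') \<or>
     (j \<in> set (tested st) \<and> j \<in> set (tested st') \<and> (\<forall>S. j \<notin> S \<longrightarrow> dual st S = dual st' S))"

text \<open>The step that tests \<open>j\<close> fixes its choice and its dual before observing
  \<open>j\<close>, hence alike in both runs. Afterwards the runs may diverge, or stop at different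
  times.\<close>

lemma agree_off_next:
  assumes "agree_off j st st'"
  shows "agree_off j (adg_next a st) (adg_next (a(j := v)) st')"
proof (cases "j \<in> set (tested st)")
  case True
  then show ?thesis
    using assms by (auto simp: agree_off_def adg_next_def adg_step_def Let_def)
next
  case False
  then have [simp]: "st' = st" using assms by (auto simp: agree_off_def)
  show ?thesis
    using False by (auto simp: agree_off_def adg_next_def adg_step_def Let_def)
qed

lemma agree_off_final: "agree_off j (adg_final a) (adg_final (a(j := v)))"
proof -
  have "agree_off j ((adg_next a ^^ k) adg_init) ((adg_next (a(j := v)) ^^ k) adg_init)" for k
    by (induction k) (simp_all add: agree_off_next del: fun_upd_apply, simp add: agree_off_def adg_init_def)
  then show ?thesis by (simp add: adg_final_def)
qed

lemma tested_final_update_iff: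
  "j \<in> set (tested (adg_final (a(j := v)))) \<longleftrightarrow> j \<in> set (tested (adg_final a))"
  using agree_off_final[of j a v] by (auto simp: agree_off_def)

lemma dual_final_update: "j \<notin> S \<Longrightarrow> dual (adg_final (a(j := v))) S = dual (adg_final a) S"
  using agree_off_final[of j a v] by (auto simp: agree_off_def)

section \<open>Charges and their expectation\<close>

definition charge :: "nat \<Rightarrow> assignment \<Rightarrow> real" where
  "charge j a = (\<Sum>S\<in>Pow {1..n}. set_gain g S a j * dual (adg_final a) S)"

text \<open>A set containing \<open>j\<close> has gain 0, and the dual of any other set ignores the
  state of \<open>j\<close>; so averaging acts on the gains alone.\<close>

lemma resample_charge: "resample p j (charge j) a = load a (dual (adg_final a)) j"
proof -
  have "set_gain g S (a(j \<mapsto> l)) j * dual (adg_final (a(j \<mapsto> l))) S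
      = set_gain g S (a(j \<mapsto> l)) j * dual (adg_final a) S" for S l
    by (cases "j \<in> S") (simp_all add: set_gain_mem dual_final_update)
  then have "resample p j (charge j) a
      = p j * (\<Sum>S\<in>Pow {1..n}. set_gain g S (a(j \<mapsto> True)) j * dual (adg_final a) S)
      + (1 - p j) * (\<Sum>S\<in>Pow {1..n}. set_gain g S (a(j \<mapsto> False)) j * dual (adg_final a) S)"
    by (simp only: resample_def charge_def)
  also have "\<dots> = load a (dual (adg_final a)) j"
    unfolding load_def exp_set_gain_def
    by (simp only: sum_distrib_left distrib_right mult.assoc sum.distrib)
  finally show ?thesis .
qed

text \<open>
  Whether \<open>j\<close> is tested does not depend on the state of \<open>j\<close>, so the charge of a tested item may be
  averaged over that state, which turns it into the left-hand side of the dual constraint.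
\<close>

lemma expectation_charge:
  assumes L: "\<And>a. a \<in> full_assignments n \<Longrightarrow> L a \<subseteq> {1..n}"
    and upd: "\<And>a j v. j \<in> L (a(j := v)) \<longleftrightarrow> j \<in> L a"
  shows "measure_pmf.expectation (state_pmf n p) (\<lambda>a. \<Sum>j\<in>L a. charge j a)
       = measure_pmf.expectation (state_pmf n p) (\<lambda>a. \<Sum>j\<in>L a. load a (dual (adg_final a)) j)"
proof -
  let ?E = "measure_pmf.expectation (state_pmf n p)"
  have split: "?E (\<lambda>a. \<Sum>j\<in>L a. f j a) = (\<Sum>j\<in>{1..n}. ?E (\<lambda>a. of_bool (j \<in> L a) * f j a))"
    for f :: "nat \<Rightarrow> assignment \<Rightarrow> real"
  proof -
    have "?E (\<lambda>a. \<Sum>j\<in>L a. f j a) = ?E (\<lambda>a. \<Sum>j\<in>{1..n}. of_bool (j \<in> L a) * f j a)"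
    proof (rule expectation_cong_full)
      fix a assume "a \<in> full_assignments n"
      then show "(\<Sum>j\<in>L a. f j a) = (\<Sum>j\<in>{1..n}. of_bool (j \<in> L a) * f j a)"
        using L by (intro sum.mono_neutral_cong_left) auto
    qed
    also have "\<dots> = (\<Sum>j\<in>{1..n}. ?E (\<lambda>a. of_bool (j \<in> L a) * f j a))"
      by (rule Bochner_Integration.integral_sum) (rule integrable_state_pmf)
    finally show ?thesis .
  qed
  have "?E (\<lambda>a. of_bool (j \<in> L a) * charge j a)
      = ?E (\<lambda>a. of_bool (j \<in> L a) * load a (dual (adg_final a)) j)" if j: "j \<in> {1..n}" for j
  proof -
    have "resample p j (\<lambda>a. of_bool (j \<in> L a) * charge j a)
        = (\<lambda>a. of_bool (j \<in> L a) * load a (dual (adg_final a)) j)"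
      unfolding resample_charge[symmetric] by (simp add: resample_def fun_eq_iff upd algebra_simps)
    then show ?thesis
      using expectation_resample[where p = p, OF j prob[OF j], of "\<lambda>a. of_bool (j \<in> L a) * charge j a"]
      by simp
  qed
  then show ?thesis unfolding split by simp
qed

section \<open>Dual value as a lower bound for covering strategies\<close>

definition dual_value :: "assignment \<Rightarrow> real" where
  "dual_value a = (\<Sum>S\<in>Pow {1..n}. dual (adg_final a) S * (real Q - real (g (a |` S))))"

text \<open>Weak duality: the tested items complete every \<open>S\<close> to a cover, so their
  gains over \<open>S\<close> sum to at least what \<open>S\<close> lacks; on average the charges
  are loads, which the costs bound.\<close>

lemma expectation_dual_value_le:
  assumes cov: "covers_from n g Q Map.empty T"
  shows "measure_pmf.expectation (state_pmf n p) dual_value \<le> strategy_cost n c p T"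
proof -
  let ?E = "measure_pmf.expectation (state_pmf n p)" and ?L = "\<lambda>a. set (items_tested T a)"
  have it: "distinct (items_tested T a)" "?L a \<subseteq> {1..n}" "g (a |` ?L a) = Q"
    if "a \<in> full_assignments n" for a
    using items_tested_covers[OF cov, of a] that by auto
  have "?E dual_value \<le> ?E (\<lambda>a. \<Sum>j\<in>?L a. charge j a)"
  proof (rule expectation_mono_full)
    fix a assume a: "a \<in> full_assignments n"
    have "dual_value a \<le> (\<Sum>S\<in>Pow {1..n}. dual (adg_final a) S * (\<Sum>j\<in>?L a. set_gain g S a j))"
      unfolding dual_value_def
    proof (intro sum_mono mult_left_mono)
      fix S
      have "Q \<le> g (a |` (?L a \<union> S))" if "S \<subseteq> {1..n}"
        using g_mono_submodular[OF a, of S "?L a"] it(3)[OF a] that by simp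
      then show "real Q - real (g (a |` S)) \<le> (\<Sum>j\<in>?L a. set_gain g S a j)" if "S \<in> Pow {1..n}"
        using g_mono_submodular[OF a it(2)[OF a], of S] that by (simp add: Un_commute)
      show "0 \<le> dual (adg_final a) S" using adg_inv_final[OF a] by (simp add: adg_inv_def)
    qed
    also have "\<dots> = (\<Sum>j\<in>?L a. charge j a)"
      unfolding charge_def sum_distrib_left by (subst sum.swap) (simp add: mult.commute)
    finally show "dual_value a \<le> (\<Sum>j\<in>?L a. charge j a)" .
  qed
  also have "\<dots> = ?E (\<lambda>a. \<Sum>j\<in>?L a. load a (dual (adg_final a)) j)"
    by (rule expectation_charge) (use it items_tested_update_iff in auto)
  also have "\<dots> \<le> ?E (\<lambda>a. \<Sum>j\<leftarrow>items_tested T a. c j)"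
  proof (rule expectation_mono_full)
    fix a assume a: "a \<in> full_assignments n"
    have "(\<Sum>j\<in>?L a. load a (dual (adg_final a)) j) \<le> (\<Sum>j\<in>?L a. c j)"
      using adg_inv_final[OF a] it(2)[OF a] by (intro sum_mono) (auto simp: adg_inv_def)
    then show "(\<Sum>j\<in>?L a. load a (dual (adg_final a)) j) \<le> (\<Sum>j\<leftarrow>items_tested T a. c j)"
      using it(1)[OF a] by (simp add: sum_list_distinct_conv_sum_set)
  qed
  finally show ?thesis by (simp add: strategy_cost_def)
qed

section \<open>Upper bound on the cost of ADG\<close>

lemma adg_items_final: "a \<in> full_assignments n \<Longrightarrow> adg_items n g Q c p sel a = tested (adg_final a)"
  by (simp add: adg_items_def adg_eq_final)

lemma adg_alpha_ge:
  assumes a: "a \<in> full_assignments n" and S: "S \<in> prefix_sets (tested (adg_final a))"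
    and g: "g (a |` S) < Q"
  shows "(\<Sum>j\<in>set (tested (adg_final a)). set_gain g S a j)
      \<le> adg_alpha n g Q c p sel * (real Q - real (g (a |` S)))"
proof -
  let ?f = "\<lambda>(a, S). (\<Sum>j \<in> set (adg_items n g Q c p sel a). set_gain g S a j) / (real Q - real (g (a |` S)))"
  let ?A = "{?f (a, S) | a S. a \<in> full_assignments n \<and> S \<in> prefix_sets (adg_items n g Q c p sel a) \<and>
          real Q - real (g (a |` S)) \<noteq> 0}"
  \<comment> \<open>Prefix sets lie in \<open>Pow {1..n}\<close>, which makes the set under the
    maximum finite.\<close>
  have "prefix_sets (adg_items n g Q c p sel a) \<subseteq> Pow {1..n}" if "a \<in> full_assignments n" for a
    using adg_inv_final[OF that] set_mono_prefix
    by (fastforce simp: prefix_sets_def adg_items_final[OF that] adg_inv_def)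
  then have "?A \<subseteq> ?f ` (full_assignments n \<times> Pow {1..n})" by blast
  then have "finite ?A" by (rule finite_subset) (simp add: finite_full_assignments)
  moreover have "?f (a, S) \<in> ?A"
    using a S g adg_items_final[OF a] by fastforce
  ultimately have "?f (a, S) \<le> Max ?A" by (rule Max_ge)
  then show ?thesis
    using g by (simp add: adg_alpha_def adg_items_final[OF a] pos_divide_le_eq)
qed

lemma adg_cost_le: "adg_cost n g Q c p sel
    \<le> adg_alpha n g Q c p sel * measure_pmf.expectation (state_pmf n p) dual_value"
proof -
  let ?E = "measure_pmf.expectation (state_pmf n p)" and ?L = "\<lambda>a. set (tested (adg_final a))"
    and ?\<alpha> = "adg_alpha n g Q c p sel"
  have inv: "adg_inv a (adg_final a)" if "a \<in> full_assignments n" for a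
    using that by (rule adg_inv_final)
  have "adg_cost n g Q c p sel = ?E (\<lambda>a. \<Sum>j\<in>?L a. load a (dual (adg_final a)) j)"
    unfolding adg_cost_def
    by (rule expectation_cong_full)
      (use inv in \<open>auto simp: adg_items_final adg_inv_def sum_list_distinct_conv_sum_set\<close>)
  also have "\<dots> = ?E (\<lambda>a. \<Sum>j\<in>?L a. charge j a)"
    by (rule expectation_charge[symmetric])
      (use inv tested_final_update_iff in \<open>auto simp: adg_inv_def\<close>)
  also have "\<dots> \<le> ?E (\<lambda>a. ?\<alpha> * dual_value a)"
  proof (rule expectation_mono_full)
    fix a assume a: "a \<in> full_assignments n"
    have "(\<Sum>j\<in>?L a. charge j a)
        = (\<Sum>S\<in>Pow {1..n}. dual (adg_final a) S * (\<Sum>j\<in>?L a. set_gain g S a j))"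
      unfolding charge_def sum_distrib_left by (subst sum.swap) (simp add: mult.commute)
    also have "\<dots> \<le> (\<Sum>S\<in>Pow {1..n}. dual (adg_final a) S * (?\<alpha> * (real Q - real (g (a |` S)))))"
    proof (rule sum_mono)
      fix S
      \<comment> \<open>A nonzero dual belongs to a prefix of the run that misses the goal, so its
        quotient is under the maximum \<alpha>.\<close>
      show "dual (adg_final a) S * (\<Sum>j\<in>?L a. set_gain g S a j)
          \<le> dual (adg_final a) S * (?\<alpha> * (real Q - real (g (a |` S))))"
        using inv[OF a] adg_alpha_ge[OF a, of S]
        by (cases "dual (adg_final a) S = 0") (auto simp: adg_inv_def intro!: mult_left_mono)
    qed
    also have "\<dots> = ?\<alpha> * dual_value a"
      by (simp add: dual_value_def sum_distrib_left algebra_simps)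
    finally show "(\<Sum>j\<in>?L a. charge j a) \<le> ?\<alpha> * dual_value a" .
  qed
  finally show ?thesis by simp
qed

text \<open>The empty prefix gives a nonnegative quotient with denominator \<open>Q\<close>. The
  sign lets \<alpha> multiply the weak duality bound.\<close>

lemma adg_alpha_nonneg:
  assumes "0 < Q"
  shows "0 \<le> adg_alpha n g Q c p sel"
proof -
  define a :: assignment where "a = (\<lambda>i. if i \<in> {1..n} then Some True else None)"
  have a: "a \<in> full_assignments n"
    by (auto simp: a_def full_assignments_def domIff split: if_splits)
  have "0 \<le> (\<Sum>j\<in>set (tested (adg_final a)). set_gain g {} a j)"
    using adg_inv_final[OF a] set_gain_nonneg[OF a] by (intro sum_nonneg) (auto simp: adg_inv_def)
  also have "\<dots> \<le> adg_alpha n g Q c p sel * real Q"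
    using adg_alpha_ge[OF a, of "{}"] assms g_empty by (simp add: prefix_sets_def)
  finally show ?thesis using assms by (simp add: zero_le_mult_iff)
qed

end

theorem theorem4:
  fixes n Q :: nat and g :: "assignment \<Rightarrow> nat" and c p :: "nat \<Rightarrow> real"
    and sel :: tie_breaker and OPT :: strategy
  assumes "sssc_instance n g Q c p"
    and "tie_breaking sel"
    and "optimal_strategy n g Q c p OPT"
  shows "(\<forall>a \<in> full_assignments n. \<exists>st. adg n g Q c p sel a = Some st \<and> g (obs st) = Q) \<and>
    adg_cost n g Q c p sel \<le> adg_alpha n g Q c p sel * strategy_cost n c p OPT"
proof -
  interpret adg_setting n Q g c p sel
    using assms(1,2) by unfold_locales
  have OPT: "covers_from n g Q Map.empty OPT"
    using assms(3) by (simp add: optimal_strategy_def is_arg_min_def)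
  have "adg_cost n g Q c p sel \<le> adg_alpha n g Q c p sel * strategy_cost n c p OPT"
  proof (cases "Q = 0")
    case True
    \<comment> \<open>For \<open>Q = 0\<close> every denominator vanishes and \<alpha> is the
      maximum of an empty set, but both costs are 0.\<close>
    then have "OPT = Stop" using OPT g_empty by (cases OPT) auto
    moreover have "adg_cost n g Q c p sel = 0"
      using True by (simp add: adg_cost_def adg_items_def adg_def while_option_unfold adg_init_def)
    ultimately show ?thesis by (simp add: strategy_cost_def)
  next
    case False
    then show ?thesis
      using adg_cost_le mult_left_mono[OF expectation_dual_value_le[OF OPT] adg_alpha_nonneg]
      by linarith
  qed
  then show ?thesis using adg_eq_final adg_final_covers by blast
qed

end
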